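(* Let $\mathcal{A}=(Q,T)$ be a strongly connected $d$-dimensional VASS. Then $\mathcal{A}$ is terminating with $\mathcal{L}(n)\in\mathcal{O}(n)$ (i.e., $\mathcal{A}$ has linear termination complexity) if and only if there exists a ranking function for $\mathcal{A}$.
   Context: A $d$-dimensional VASS is a pair $\mathcal{A}=(Q,T)$ where $Q$ is a finite nonempty set of states and $T\subseteq Q\times\mathbb{Z}^d\times Q$ is a finite set of transitions such that every state has at least one outgoing transition. A configuration is a pair $p\mathbf{v}$ with $p\in Q$, $\mathbf{v}\in\mathbb{N}^d$; its size is $\max_{1\le i\le d}\mathbf{v}(i)$. A computation initiated in $p_0\mathbf{v}_0$ is a finite sequence of configurations $p_0\mathbf{v}_0,\dots,p_n\mathbf{v}_n$ (all with vectors in $\mathbb{N}^d$) such that for each $i<n$ there is a transition $(p_i,\mathbf{u}_{i+1},p_{i+1})\in T$ with $\mathbf{v}_{i+1}=\mathbf{v}_i+\mathbf{u}_{i+1}$; its length is $n$. $L(p\mathbf{v})\in\mathbb{N}\cup\{\infty\}$ is the least bound on the lengths of all computations initiated in $p\mathbf{v}$, and the termination complexity is $\mathcal{L}(n)=\sup\{L(p\mathbf{v}) : p\mathbf{v}\text{ a configuration of size } n\}$. $\mathcal{A}$ is terminating if $\mathcal{L}(n)<\infty$ for all $n$. A finite path is a sequence $p_0,\mathbf{u}_1,p_1,\dots,\mathbf{u}_n,p_n$ with $n\ge1$ and $(p_i,\mathbf{u}_{i+1},p_{i+1})\in T$; $\mathcal{A}$ is strongly connected if there is a finite path from every state to every state.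 A linear map for $\mathcal{A}$ is a function $f(p\mathbf{v})=\mathbf{c}_f^\top\mathbf{v}+\mathbf{w}_f(p)$ with $\mathbf{c}_f\in\mathbb{Q}^d$ (the normal) and $\mathbf{w}_f\in\mathbb{Q}^Q$. A transition $(p,\mathbf{u},q)$ is $f$-ranked if $\mathbf{c}_f^\top\mathbf{u}+\mathbf{w}_f(q)\le\mathbf{w}_f(p)-1$. A ranking function is a linear map $f$ with $\mathbf{c}_f\ge\vec 0$ such that every transition of $\mathcal{A}$ is $f$-ranked. *)

theory Defs
  imports
    "HOL-Analysis.Analysis"
    "HOL-Library.Extended_Nat"
    "HOL-Library.Landau_Symbols"
begin

text \<open>
  The dimension is the cardinality of a finite index type \<open>'d\<close>. It is at least 1, as the size of a
  configuration (a maximum over all components) requires.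
\<close>

type_synonym ('q, 'd) transition = "'q \<times> (int ^ 'd) \<times> 'q"
type_synonym ('q, 'd) config = "'q \<times> (nat ^ 'd)"

definition vass :: "'q set \<Rightarrow> ('q, 'd::finite) transition set \<Rightarrow> bool" where
  "vass Q T \<longleftrightarrow>
     finite Q \<and> Q \<noteq> {} \<and> finite T \<and> T \<subseteq> Q \<times> UNIV \<times> Q \<and>
     (\<forall>p\<in>Q. \<exists>u q. (p, u, q) \<in> T)"

definition configs :: "'q set \<Rightarrow> ('q, 'd::finite) config set" where
  "configs Q = Q \<times> UNIV"

definition config_size :: "('q, 'd::finite) config \<Rightarrow> nat" where
  "config_size c = Max (range (\<lambda>i. snd c $ i))"

definition step :: "('q, 'd::finite) transition set \<Rightarrow> ('q, 'd) config \<Rightarrow> ('q, 'd) config \<Rightarrow> bool"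
  where
  "step T c c' \<longleftrightarrow>
     (\<exists>u. (fst c, u, fst c') \<in> T \<and> (\<forall>i. int (snd c' $ i) = int (snd c $ i) + u $ i))"

definition computation ::
  "'q set \<Rightarrow> ('q, 'd::finite) transition set \<Rightarrow> ('q, 'd) config \<Rightarrow> ('q, 'd) config list \<Rightarrow> bool"
  where
  "computation Q T c0 cs \<longleftrightarrow>
     cs \<noteq> [] \<and> hd cs = c0 \<and> set cs \<subseteq> configs Q \<and>
     (\<forall>i. Suc i < length cs \<longrightarrow> step T (cs ! i) (cs ! Suc i))"

text \<open>A computation with \<open>n + 1\<close> configurations has length \<open>n\<close>.\<close>

definition comp_bound ::
  "'q set \<Rightarrow> ('q, 'd::finite) transition set \<Rightarrow> ('q, 'd) config \<Rightarrow> enat" where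
  "comp_bound Q T c0 = (SUP cs \<in> {cs. computation Q T c0 cs}. enat (length cs - 1))"

definition termination_complexity ::
  "'q set \<Rightarrow> ('q, 'd::finite) transition set \<Rightarrow> nat \<Rightarrow> enat" where
  "termination_complexity Q T n =
     (SUP c \<in> {c \<in> configs Q. config_size c = n}. comp_bound Q T c)"

definition terminating :: "'q set \<Rightarrow> ('q, 'd::finite) transition set \<Rightarrow> bool" where
  "terminating Q T \<longleftrightarrow> (\<forall>n. termination_complexity Q T n < \<infinity>)"

definition finite_path ::
  "('q, 'd::finite) transition set \<Rightarrow> 'q list \<Rightarrow> (int ^ 'd) list \<Rightarrow> bool" where
  "finite_path T ps us \<longleftrightarrow>
     length us \<ge> 1 \<and> length ps = length us + 1 \<and>
     (\<forall>i < length us. (ps ! i, us ! i, ps ! Suc i) \<in> T)"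

definition strongly_connected :: "'q set \<Rightarrow> ('q, 'd::finite) transition set \<Rightarrow> bool" where
  "strongly_connected Q T \<longleftrightarrow>
     (\<forall>p\<in>Q. \<forall>q\<in>Q. \<exists>ps us. finite_path T ps us \<and> hd ps = p \<and> last ps = q)"

text \<open>
  In \<open>is_linear_map Q f c w\<close>, \<open>c\<close> is the normal of \<open>f\<close>; only the values of \<open>f\<close> on configurations and
  of \<open>w\<close> on \<open>Q\<close> matter.
\<close>

definition is_linear_map ::
  "'q set \<Rightarrow> (('q, 'd::finite) config \<Rightarrow> rat) \<Rightarrow> rat ^ 'd \<Rightarrow> ('q \<Rightarrow> rat) \<Rightarrow> bool" where
  "is_linear_map Q f c w \<longleftrightarrow>
     (\<forall>(p, v) \<in> configs Q. f (p, v) = (\<Sum>i\<in>UNIV. c $ i * of_nat (v $ i)) + w p)"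

definition ranked :: "rat ^ 'd \<Rightarrow> ('q \<Rightarrow> rat) \<Rightarrow> ('q, 'd::finite) transition \<Rightarrow> bool" where
  "ranked c w t \<longleftrightarrow>
     (case t of (p, u, q) \<Rightarrow> (\<Sum>i\<in>UNIV. c $ i * of_int (u $ i)) + w q \<le> w p - 1)"

definition ranking_function ::
  "'q set \<Rightarrow> ('q, 'd::finite) transition set \<Rightarrow> (('q, 'd) config \<Rightarrow> rat) \<Rightarrow> bool" where
  "ranking_function Q T f \<longleftrightarrow>
     (\<exists>c w. is_linear_map Q f c w \<and> (\<forall>i. 0 \<le> c $ i) \<and> (\<forall>t\<in>T. ranked c w t))"

end

theory Submission
  imports Defs
begin

text \<open>
  Consider the finitely many closed walks of length at most \<open>card Q + 1\<close>. If the convex hull of their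
  effects misses the nonnegative orthant, a hyperplane separating the two has a normal \<open>c \<ge> 0\<close> along
  which every cycle strictly decreases; a small perturbation makes \<open>c\<close> rational, and longest-path
  potentials extend it to a ranking function. Otherwise some real convex combination of cycle effects
  is nonnegative. Taking each cycle \<open>\<lceil>m * l\<rceil>\<close> times, where \<open>l\<close> is its coefficient, and joining the
  cycles by connecting walks gives a closed walk of length at least \<open>m\<close> and at most linear in \<open>m\<close>
  whose effect is bounded below independently of \<open>m\<close>, since rounding and connecting cost only a
  constant. Repeating it \<open>m\<close> times is possible from counter values linear in \<open>m\<close>, so the termination
  complexity is at least quadratic.
\<close>

section \<open>Walks, their effects, and cycles inside long walks\<close>

text \<open>Unlike \<open>finite_path\<close>, this admits the empty walk, so joining and splitting
  walks is just list append, with the intermediate state as witness.\<close>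

fun walk :: "('q, 'd::finite) transition set \<Rightarrow> 'q \<Rightarrow> ('q, 'd) transition list \<Rightarrow> 'q \<Rightarrow> bool" where
  "walk T p [] q \<longleftrightarrow> p = q"
| "walk T p (t # ts) q \<longleftrightarrow> t \<in> T \<and> fst t = p \<and> walk T (snd (snd t)) ts q"

definition effect :: "('q, 'd::finite) transition list \<Rightarrow> int ^ 'd" where
  "effect ts = (\<Sum>t\<leftarrow>ts. fst (snd t))"

lemma effect_simps [simp]:
  "effect [] = 0"
  "effect (t # ts) = fst (snd t) + effect ts"
  "effect (xs @ ys) = effect xs + effect ys"
  by (simp_all add: effect_def)

lemma walk_append: "walk T p (xs @ ys) q \<longleftrightarrow> (\<exists>r. walk T p xs r \<and> walk T r ys q)"
  by (induction xs arbitrary: p) auto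

lemma walk_subset: "walk T p ts q \<Longrightarrow> set ts \<subseteq> T"
  by (induction ts arbitrary: p) auto

lemma walk_sources:
  assumes "T \<subseteq> Q \<times> UNIV \<times> Q" and "walk T p ts q"
  shows "fst ` set ts \<subseteq> Q"
  using walk_subset[OF assms(2)] assms(1) by force

lemma walk_replicate: "walk T p ts p \<Longrightarrow> walk T p (concat (replicate k ts)) p"
  by (induction k) (auto simp: walk_append)

lemma effect_replicate: "effect (concat (replicate k ts)) $ i = int k * effect ts $ i"
  by (induction k) (auto simp: algebra_simps)

lemma length_concat_replicate: "length (concat (replicate k ts)) = k * length ts"
  by (induction k) auto

lemma finite_path_imp_walk:
  assumes "finite_path T ps us"
  shows "\<exists>ts. walk T (hd ps) ts (last ps)"
  using assms
proof (induction us arbitrary: ps)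
  case Nil
  then show ?case by (simp add: finite_path_def)
next
  case (Cons u us)
  then obtain p ps' where ps: "ps = p # ps'" and len: "length ps' = Suc (length us)"
    by (cases ps) (auto simp: finite_path_def)
  then have ne: "ps' \<noteq> []" by auto
  have "\<forall>i < Suc (length us). (ps ! i, (u # us) ! i, ps ! Suc i) \<in> T"
    using Cons.prems by (simp add: finite_path_def)
  then have t: "(p, u, hd ps') \<in> T"
    and rest: "\<And>i. i < length us \<Longrightarrow> (ps' ! i, us ! i, ps' ! Suc i) \<in> T"
    using ps ne by (force simp: hd_conv_nth)+
  \<comment> \<open>\<open>finite_path\<close> demands at least one transition, so the induction
    hypothesis says nothing about an exhausted path; the empty walk covers that case.\<close>
  have "\<exists>ts. walk T (hd ps') ts (last ps')"
  proof (cases us)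
    case Nil
    with len have "walk T (hd ps') [] (last ps')" by (cases ps') auto
    then show ?thesis ..
  next
    case (Cons a list)
    then have "finite_path T ps' us"
      using rest len by (auto simp: finite_path_def)
    then show ?thesis by (rule Cons.IH)
  qed
  then obtain ts where "walk T (hd ps') ts (last ps')" ..
  then have "walk T (hd ps) ((p, u, hd ps') # ts) (last ps)"
    using t ps ne by simp
  then show ?case ..
qed

lemma strongly_connected_walk:
  assumes "strongly_connected Q T" "p \<in> Q" "q \<in> Q"
  obtains ts where "walk T p ts q"
  using assms finite_path_imp_walk unfolding strongly_connected_def by metis

text \<open>Pigeonhole on the sources of the transitions: more than \<open>card Q\<close> of them
  cannot be distinct. The segment between two transitions with the same source is the cycle.\<close>

lemma walk_contains_cycle:
  assumes "finite Q" "T \<subseteq> Q \<times> UNIV \<times> Q" "walk T p ts q" "card Q < length ts"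
  obtains xs ys zs r where "ts = xs @ ys @ zs" "ys \<noteq> []"
    "walk T p xs r" "walk T r ys r" "walk T r zs q"
proof -
  have "card (fst ` set ts) \<le> card Q"
    using walk_sources[OF assms(2,3)] assms(1) by (simp add: card_mono)
  then have "\<not> distinct (map fst ts)"
    using assms(4) by (metis distinct_card leD length_map list.set_map)
  then obtain us vs ws y where "map fst ts = us @ [y] @ vs @ [y] @ ws"
    using not_distinct_decomp by blast
  then obtain xs a bs b cs where ts: "ts = xs @ (a # bs) @ (b # cs)" "fst a = y" "fst b = y"
    by (auto simp: map_eq_append_conv map_eq_Cons_conv append_eq_map_conv Cons_eq_map_conv)
  then have "walk T p xs y" "walk T y (a # bs) y" "walk T y (b # cs) q"
    using assms(3) by (auto simp: walk_append)
  with ts show thesis by (intro that[of xs "a # bs" "b # cs" y]) auto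
qed

section \<open>Short cycles and longest-path potentials\<close>

text \<open>Cycles need not be simple. The bound \<open>Suc (card Q)\<close> fits any cycle cut out
  of a walk of length at most \<open>card Q\<close> that has been extended by one
  transition.\<close>

definition short_cycles :: "'q set \<Rightarrow> ('q, 'd::finite) transition set \<Rightarrow> ('q, 'd) transition list set"
  where "short_cycles Q T =
    {ts. ts \<noteq> [] \<and> length ts \<le> Suc (card Q) \<and> (\<exists>p\<in>Q. walk T p ts p)}"

lemma finite_short_cycles:
  assumes "finite T"
  shows "finite (short_cycles Q T)"
proof (rule finite_subset)
  show "short_cycles Q T \<subseteq> {ts. set ts \<subseteq> T \<and> length ts \<le> Suc (card Q)}"
    by (auto simp: short_cycles_def dest: walk_subset)
  show "finite {ts. set ts \<subseteq> T \<and> length ts \<le> Suc (card Q)}"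
    using assms by (rule finite_lists_length_le)
qed

text \<open>
  The potential of a state is the largest weight of a walk of length at most \<open>card Q\<close> from it, where
  a transition with update \<open>u\<close> weighs \<open>c \<bullet> u + 1\<close>. Cutting out a cycle does not decrease the
  weight, so longer walks cannot exceed it.
\<close>

lemma ranked_if_cycles_decrease:
  fixes T :: "('q, 'd::finite) transition set" and c :: "rat ^ 'd"
  assumes V: "vass Q T"
    and dec: "\<And>ts. ts \<in> short_cycles Q T \<Longrightarrow>
      (\<Sum>i\<in>UNIV. c $ i * of_int (effect ts $ i)) \<le> - of_nat (length ts)"
  shows "\<exists>w. \<forall>t\<in>T. ranked c w t"
proof -
  from V have fin: "finite Q" "finite T" and sub: "T \<subseteq> Q \<times> UNIV \<times> Q"
    by (auto simp: vass_def)
  define wt :: "('q, 'd) transition list \<Rightarrow> rat"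
    where "wt ts = (\<Sum>i\<in>UNIV. c $ i * of_int (effect ts $ i)) + of_nat (length ts)" for ts
  have wt_app: "wt (xs @ ys) = wt xs + wt ys" for xs ys
    by (simp add: wt_def algebra_simps sum.distrib)
  define W where "W p = {ts. (\<exists>q. walk T p ts q) \<and> length ts \<le> card Q}" for p
  define w where "w p = Max (wt ` W p)" for p
  have finW: "finite (W p)" for p
  proof (rule finite_subset)
    show "W p \<subseteq> {ts. set ts \<subseteq> T \<and> length ts \<le> card Q}"
      by (auto simp: W_def dest: walk_subset)
    show "finite {ts. set ts \<subseteq> T \<and> length ts \<le> card Q}"
      using fin(2) by (rule finite_lists_length_le)
  qed
  have neW: "W p \<noteq> {}" for p
    using walk.simps(1)[of T p p] by (auto simp: W_def intro!: exI[of _ "[]"])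
  have "ranked c w t" if "t \<in> T" for t
  proof -
    obtain p u q where t: "t = (p, u, q)" by (cases t)
    have "w q \<in> wt ` W q" unfolding w_def using finW neW by (intro Max_in) auto
    then obtain ts r where ts: "w q = wt ts" "walk T q ts r" "length ts \<le> card Q"
      by (auto simp: W_def)
    have wk: "walk T p (t # ts) r" using ts that t by simp
    \<comment> \<open>This suffices: with \<open>w q = wt ts\<close>, the weight of
      \<open>t # ts\<close> is the change along \<open>u\<close> plus 1 plus \<open>w q\<close>, so
      bounding it by \<open>w p\<close> is exactly the ranking inequality for
      \<open>t\<close>.\<close>
    have le: "\<exists>ts'\<in>W p. wt (t # ts) \<le> wt ts'"
    proof (cases "Suc (length ts) \<le> card Q")
      case True
      then have "t # ts \<in> W p" using wk by (auto simp: W_def)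
      then show ?thesis by blast
    next
      case False
      then have "card Q < length (t # ts)" by simp
      from walk_contains_cycle[OF fin(1) sub wk this]
      obtain xs ys zs s where d: "t # ts = xs @ ys @ zs" "ys \<noteq> []"
        "walk T p xs s" "walk T s ys s" "walk T s zs r" by blast
      have len: "Suc (length ts) = length xs + length ys + length zs"
        using arg_cong[OF d(1), of length] by simp
      \<comment> \<open>As \<open>ys\<close> is nonempty, \<open>s\<close> is the source of its
        first transition.\<close>
      have "s \<in> Q" using d(2,4) walk_sources[OF sub d(4)] by (cases ys) auto
      then have "ys \<in> short_cycles Q T"
        using d len ts(3) by (auto simp: short_cycles_def)
      from dec[OF this] have "wt ys \<le> 0" by (simp add: wt_def)
      moreover have "xs @ zs \<in> W p"
      proof -
        have "length ys > 0" using d(2) by simp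
        then have "length (xs @ zs) \<le> card Q" using len ts(3) unfolding length_append by linarith
        moreover have "walk T p (xs @ zs) r" using d by (auto simp: walk_append)
        ultimately show ?thesis unfolding W_def by blast
      qed
      ultimately show ?thesis
        by (intro bexI[of _ "xs @ zs"]) (auto simp: d(1) wt_app)
    qed
    then have "wt (t # ts) \<le> w p"
      unfolding w_def using finW by (meson Max_ge finite_imageI image_eqI order_trans)
    moreover have "wt (t # ts) = (\<Sum>i\<in>UNIV. c $ i * of_int (u $ i)) + 1 + w q"
      using wt_app[of "[t]" ts] ts(1) by (simp add: wt_def t)
    ultimately show ?thesis by (simp add: ranked_def t)
  qed
  then show ?thesis by blast
qed

section \<open>Separation from the nonnegative orthant\<close>

text \<open>A theorem of the alternative of Ville type. The hull is compact and the orthant closed,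
  so disjointness gives strict separation; a functional bounded below on the orthant has nonnegative
  coefficients.\<close>

lemma nonneg_separation_or_convex_combination:
  fixes S :: "(real ^ 'd::finite) set"
  assumes "finite S"
  shows "(\<exists>c. (\<forall>i. 0 \<le> c $ i) \<and> (\<forall>x\<in>S. c \<bullet> x < 0)) \<or>
    (\<exists>l. (\<forall>x\<in>S. 0 \<le> l x) \<and> sum l S = 1 \<and> (\<forall>i. 0 \<le> (\<Sum>x\<in>S. l x * x $ i)))"
proof (cases "S = {}")
  case True
  then show ?thesis by (auto intro!: exI[of _ 0])
next
  case False
  define P where "P = {x :: real ^ 'd. \<forall>i. 0 \<le> x $ i}"
  have P: "convex P" "closed P" "0 \<in> P"
    unfolding P_def convex_def
    by (auto intro!: add_nonneg_nonneg mult_nonneg_nonneg closed_Collect_all closed_Collect_le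
        continuous_intros)
  show ?thesis
  proof (cases "convex hull S \<inter> P = {}")
    case True
    have "compact (convex hull S)" using assms by (simp add: finite_imp_compact_convex_hull)
    with True P False obtain a b where ab:
      "\<forall>x\<in>convex hull S. a \<bullet> x < b" "\<forall>x\<in>P. b < a \<bullet> x"
      using separating_hyperplane_compact_closed[of "convex hull S" P] by auto
    have b: "b < 0" using ab(2) P(3) by force
    have "a \<bullet> x < 0" if "x \<in> S" for x
      using ab(1) b hull_inc[of x S convex] that by force
    moreover have "0 \<le> a $ i" for i
    proof (rule ccontr)
      assume neg: "\<not> 0 \<le> a $ i"
      \<comment> \<open>Both \<open>b\<close> and \<open>a $ i\<close> are negative, so this point
        is in the orthant, yet the functional takes the value \<open>b\<close> there instead of
        exceeding it.\<close>
      have "axis i (b / a $ i) \<in> P" using neg b by (auto simp: P_def axis_def divide_nonpos_nonpos)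
      then have "b < a \<bullet> axis i (b / a $ i)" using ab(2) by blast
      with neg show False by (simp add: inner_axis)
    qed
    ultimately show ?thesis by blast
  next
    case False
    then obtain x where x: "x \<in> convex hull S" "x \<in> P" by blast
    then obtain l where l: "\<forall>y\<in>S. 0 \<le> l y" "sum l S = 1" "(\<Sum>y\<in>S. l y *\<^sub>R y) = x"
      using convex_hull_finite[OF assms] by auto
    have "(\<Sum>y\<in>S. l y * y $ i) = x $ i" for i
      using arg_cong[OF l(3), of "\<lambda>z. z $ i"] by simp
    then have "\<forall>i. 0 \<le> (\<Sum>y\<in>S. l y * y $ i)" using x(2) by (simp add: P_def)
    with l(1,2) show ?thesis by blast
  qed
qed

text \<open>Finitely many strict inequalities define an open set around \<open>c\<close>. Rounding
  every coordinate up to a nearby rational stays inside it and keeps nonnegativity.\<close>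

lemma rational_nonneg_perturbation:
  fixes S :: "(real ^ 'd::finite) set" and c :: "real ^ 'd"
  assumes "finite S" "\<And>i. 0 \<le> c $ i" "\<And>x. x \<in> S \<Longrightarrow> c \<bullet> x < 0"
  shows "\<exists>r :: rat ^ 'd. (\<forall>i. 0 \<le> r $ i) \<and> (\<forall>x\<in>S. (\<Sum>i\<in>UNIV. of_rat (r $ i) * x $ i) < 0)"
proof -
  define O' where "O' = (\<Inter>x\<in>S. {y. y \<bullet> x < 0})"
  have "open O'" unfolding O'_def using assms(1)
    by (intro open_INT) (auto intro!: open_Collect_less continuous_intros)
  moreover have "c \<in> O'" using assms(3) by (auto simp: O'_def)
  ultimately obtain e where e: "e > 0" "ball c e \<subseteq> O'"
    using open_contains_ball by blast
  \<comment> \<open>The 1-norm error is then at most half of \<open>e\<close>.\<close>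
  define \<delta> where "\<delta> = e / (2 * real CARD('d))"
  have \<delta>: "\<delta> > 0" using e(1) by (simp add: \<delta>_def)
  have "\<forall>i. \<exists>r::rat. c $ i < of_rat r \<and> of_rat r < c $ i + \<delta>"
    using \<delta> by (intro allI of_rat_dense) simp
  then obtain f where f: "\<And>i. c $ i < of_rat (f i)" "\<And>i. of_rat (f i) < c $ i + \<delta>"
    by metis
  define y :: "real ^ 'd" where "y = (\<chi> i. of_rat (f i))"
  have "norm (y - c) \<le> (\<Sum>i\<in>UNIV. \<bar>(y - c) $ i\<bar>)" by (rule norm_le_l1_cart)
  also have "\<dots> \<le> (\<Sum>i\<in>(UNIV :: 'd set). \<delta>)"
  proof (rule sum_mono)
    fix i show "\<bar>(y - c) $ i\<bar> \<le> \<delta>" using f[of i] by (simp add: y_def)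
  qed
  also have "\<dots> < e" using e(1) by (simp add: \<delta>_def field_simps)
  finally have "y \<in> O'" using e(2) by (auto simp: dist_norm norm_minus_commute)
  then have "\<forall>x\<in>S. (\<Sum>i\<in>UNIV. of_rat (f i) * x $ i) < 0"
    by (auto simp: O'_def inner_vec_def y_def)
  moreover have "0 \<le> f i" for i
    using f(1)[of i] assms(2)[of i] by (metis less_eq_real_def of_rat_less_0_iff linorder_not_less
        order.strict_trans1 order_less_asym)
  ultimately show ?thesis by (intro exI[of _ "\<chi> i. f i"]) auto
qed

section \<open>Closed walks with prescribed cycle multiplicities\<close>

text \<open>
  The connecting walks between the cycles contribute a constant that does not depend on the
  multiplicities.
\<close>

lemma closed_walk_with_multiplicities:
  fixes T :: "('q, 'd::finite) transition set"
  assumes sc: "strongly_connected Q T" and "p0 \<in> Q" and "finite S"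
    and "\<And>g. g \<in> S \<Longrightarrow> \<exists>p\<in>Q. walk T p g p"
  shows "\<exists>K L. \<forall>f :: _ \<Rightarrow> nat. \<exists>ts. walk T p0 ts p0 \<and>
    (\<forall>i. effect ts $ i = K $ i + (\<Sum>g\<in>S. int (f g) * effect g $ i)) \<and>
    length ts = L + (\<Sum>g\<in>S. f g * length g)"
  using assms(3,4)
proof (induction S rule: finite_induct)
  case empty
  have "walk T p0 [] p0" by simp
  then show ?case
    by (intro exI[of _ 0] allI exI[of _ "[]"]) auto
next
  case (insert g S)
  then obtain K L where KL: "\<And>f :: _ \<Rightarrow> nat. \<exists>ts. walk T p0 ts p0 \<and>
    (\<forall>i. effect ts $ i = K $ i + (\<Sum>g\<in>S. int (f g) * effect g $ i)) \<and>
    length ts = L + (\<Sum>g\<in>S. f g * length g)" by blast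
  from insert.prems obtain p where p: "p \<in> Q" "walk T p g p" by blast
  obtain a where a: "walk T p0 a p" using strongly_connected_walk[OF sc \<open>p0 \<in> Q\<close> p(1)] .
  obtain b where b: "walk T p b p0" using strongly_connected_walk[OF sc p(1) \<open>p0 \<in> Q\<close>] .
  show ?case
  proof (intro exI[of _ "K + effect a + effect b"] exI[of _ "L + length a + length b"] allI)
    fix f :: "_ \<Rightarrow> nat"
    from KL[of f] obtain ts where ts: "walk T p0 ts p0"
      "\<And>i. effect ts $ i = K $ i + (\<Sum>g\<in>S. int (f g) * effect g $ i)"
      "length ts = L + (\<Sum>g\<in>S. f g * length g)" by blast
    \<comment> \<open>A detour from \<open>p0\<close> to \<open>p\<close>, \<open>f g\<close> rounds
      of \<open>g\<close>, and back. Since \<open>a\<close> and \<open>b\<close> are fixed before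
      \<open>f\<close>, they only enlarge the constants.\<close>
    let ?ts = "a @ concat (replicate (f g) g) @ b @ ts"
    have "walk T p0 ?ts p0"
      using a b ts(1) walk_replicate[OF p(2), of "f g"] by (auto simp: walk_append)
    moreover have "\<forall>i. effect ?ts $ i = (K + effect a + effect b) $ i
        + (\<Sum>g\<in>insert g S. int (f g) * effect g $ i)"
      using insert.hyps by (simp add: ts(2) effect_replicate)
    moreover have "length ?ts = L + length a + length b + (\<Sum>g\<in>insert g S. f g * length g)"
      using insert.hyps ts(3) length_concat_replicate[of "f g" g] by (simp del: length_concat)
    ultimately show "\<exists>ts. walk T p0 ts p0 \<and>
      (\<forall>i. effect ts $ i = (K + effect a + effect b) $ i
        + (\<Sum>g\<in>insert g S. int (f g) * effect g $ i)) \<and>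
      length ts = L + length a + length b + (\<Sum>g\<in>insert g S. f g * length g)" by blast
  qed
qed

section \<open>Counter drops along walks, and computations that follow walks\<close>

text \<open>Counters that all start at \<open>B\<close> or more stay nonnegative along the whole
  walk. Every \<open>k\<close> is allowed, so the total effect is covered too.\<close>

definition drop_le :: "int \<Rightarrow> ('q, 'd::finite) transition list \<Rightarrow> bool" where
  "drop_le B ts \<longleftrightarrow> (\<forall>k i. - B \<le> effect (take k ts) $ i)"

lemma drop_le_length:
  assumes "\<And>t i. t \<in> set ts \<Longrightarrow> \<bar>fst (snd t) $ i\<bar> \<le> U"
  shows "drop_le (U * int (length ts)) ts"
proof -
  have bnd: "\<bar>effect xs $ i\<bar> \<le> U * int (length xs)" if "set xs \<subseteq> set ts" for xs i
    using that
  proof (induction xs)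
    case (Cons t xs)
    then have "\<bar>fst (snd t) $ i\<bar> \<le> U" "\<bar>effect xs $ i\<bar> \<le> U * int (length xs)"
      using assms by auto
    then show ?case by (simp add: algebra_simps)
  qed simp
  \<comment> \<open>\<open>U\<close> could be negative for empty \<open>ts\<close>; any transition
    forces it to be nonnegative.\<close>
  have "U * int (length (take k ts)) \<le> U * int (length ts)" for k
  proof (cases ts)
    case (Cons t _)
    then have "0 \<le> U" using assms[of t undefined] by simp
    then show ?thesis by (intro mult_left_mono) auto
  qed simp
  with bnd[OF set_take_subset] show ?thesis
    unfolding drop_le_def by (smt (verit, best))
qed

text \<open>Completed rounds lose at most \<open>D\<close> each, and only the one unfinished round
  can cost \<open>B\<close>, so \<open>B\<close> is paid once rather than \<open>j\<close>
  times.\<close>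

lemma drop_le_replicate:
  assumes "drop_le B ts" "\<And>i. - D \<le> effect ts $ i" "0 \<le> D" "0 \<le> B"
  shows "drop_le (int j * D + B) (concat (replicate j ts))"
proof (induction j)
  case 0
  then show ?case using assms by (simp add: drop_le_def)
next
  case (Suc j)
  have "- (int (Suc j) * D + B) \<le> effect (take k (concat (replicate (Suc j) ts))) $ i" for k i
  proof (cases "k \<le> length ts")
    case True
    then have "- B \<le> effect (take k (concat (replicate (Suc j) ts))) $ i"
      using assms(1) by (simp add: drop_le_def)
    moreover have "0 \<le> int (Suc j) * D" using assms(3) by simp
    ultimately show ?thesis by linarith
  next
    case False
    then show ?thesis
      using Suc[unfolded drop_le_def, rule_format, of "k - length ts" i] assms(2)[of i]
      by (simp add: algebra_simps)
  qed
  then show ?case unfolding drop_le_def by blast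
qed

lemma computation_of_walk:
  fixes T :: "('q, 'd::finite) transition set" and v :: "nat ^ 'd"
  assumes "T \<subseteq> Q \<times> UNIV \<times> Q" "p \<in> Q" "walk T p ts q"
    and "\<And>k i. 0 \<le> int (v $ i) + effect (take k ts) $ i"
  shows "\<exists>cs. computation Q T (p, v) cs \<and> length cs = Suc (length ts)"
  using assms(2-)
proof (induction ts arbitrary: p v)
  case Nil
  then have "computation Q T (p, v) [(p, v)]" by (simp add: computation_def configs_def)
  then show ?case by force
next
  case (Cons t ts)
  obtain u r where t: "t = (p, u, r)" "(p, u, r) \<in> T" "walk T r ts q"
    using Cons.prems(2) by (cases t) auto
  then have r: "r \<in> Q" using assms(1) by auto
  \<comment> \<open>\<open>nat\<close> truncates nothing here: the hypothesis for the prefix of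
    length 1 makes the argument nonnegative.\<close>
  define v' :: "nat ^ 'd" where "v' = (\<chi> i. nat (int (v $ i) + u $ i))"
  have v': "int (v' $ i) = int (v $ i) + u $ i" for i
    using Cons.prems(3)[of i 1] t(1) by (simp add: v'_def)
  have "0 \<le> int (v' $ i) + effect (take k ts) $ i" for k i
    using Cons.prems(3)[of i "Suc k"] t(1) v' by simp
  from Cons.IH[OF r t(3) this] obtain cs
    where cs: "computation Q T (r, v') cs" "length cs = Suc (length ts)" by blast
  have "step T (p, v) (r, v')" using t(2) v' by (auto simp: step_def)
  then have "computation Q T (p, v) ((p, v) # cs)"
    using cs(1) \<open>p \<in> Q\<close>
    by (auto simp: computation_def configs_def nth_Cons hd_conv_nth split: nat.split)
  with cs(2) show ?case by force
qed

lemma computation_le_termination_complexity: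
  assumes "computation Q T c cs" "c \<in> configs Q"
  shows "enat (length cs - 1) \<le> termination_complexity Q T (config_size c)"
proof -
  have "enat (length cs - 1) \<le> comp_bound Q T c"
    unfolding comp_bound_def using assms(1) by (intro SUP_upper) simp
  also have "\<dots> \<le> termination_complexity Q T (config_size c)"
    unfolding termination_complexity_def using assms(2) by (intro SUP_upper) simp
  finally show ?thesis .
qed

section \<open>Quadratic lower bound and its conflict with linear growth\<close>

lemma quadratic_lower_bound:
  fixes T :: "('q, 'd::finite) transition set"
  assumes V: "vass Q T" and sc: "strongly_connected Q T"
    and S: "S \<subseteq> short_cycles Q T" "finite S"
    and l: "\<And>g. g \<in> S \<Longrightarrow> 0 \<le> l g" "sum l S = (1::real)"
      "\<And>i. 0 \<le> (\<Sum>g\<in>S. l g * of_int (effect g $ i))"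
  shows "\<exists>a b :: nat. 1 \<le> a \<and>
    (\<forall>m. enat (m * m) \<le> termination_complexity Q T (a * m + b))"
proof -
  from V have fin: "finite Q" "finite T" and sub: "T \<subseteq> Q \<times> UNIV \<times> Q" and "Q \<noteq> {}"
    by (auto simp: vass_def)
  then obtain p0 where p0: "p0 \<in> Q" by blast
  have "\<And>g. g \<in> S \<Longrightarrow> \<exists>p\<in>Q. walk T p g p" using S(1) by (auto simp: short_cycles_def)
  from closed_walk_with_multiplicities[OF sc p0 S(2) this]
  obtain K L where KL: "\<And>f :: _ \<Rightarrow> nat. \<exists>ts. walk T p0 ts p0 \<and>
    (\<forall>i. effect ts $ i = K $ i + (\<Sum>g\<in>S. int (f g) * effect g $ i)) \<and>
    length ts = L + (\<Sum>g\<in>S. f g * length g)" by blast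
  \<comment> \<open>Bounds the loss of one round in every component: \<open>K\<close> for the
    connecting walks, plus one copy of each cycle for rounding. Summing over components makes it
    uniform.\<close>
  define D where "D = nat (\<Sum>i\<in>UNIV. \<bar>K $ i\<bar> + (\<Sum>g\<in>S. \<bar>effect g $ i\<bar>))"
  have D: "\<bar>K $ i\<bar> + (\<Sum>g\<in>S. \<bar>effect g $ i\<bar>) \<le> int D" for i
  proof -
    have "\<bar>K $ i\<bar> + (\<Sum>g\<in>S. \<bar>effect g $ i\<bar>) \<le> (\<Sum>i\<in>UNIV. \<bar>K $ i\<bar> + (\<Sum>g\<in>S. \<bar>effect g $ i\<bar>))"
      by (intro member_le_sum) (auto intro!: add_nonneg_nonneg sum_nonneg)
    then show ?thesis unfolding D_def by linarith
  qed
  define U where "U = nat (\<Sum>t\<in>T. \<Sum>i\<in>UNIV. \<bar>fst (snd t) $ i\<bar>)"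
  have U: "\<bar>fst (snd t) $ i\<bar> \<le> int U" if "t \<in> T" for t i
  proof -
    have "\<bar>fst (snd t) $ i\<bar> \<le> (\<Sum>i\<in>UNIV. \<bar>fst (snd t) $ i\<bar>)"
      by (intro member_le_sum) auto
    also have "\<dots> \<le> (\<Sum>t\<in>T. \<Sum>i\<in>UNIV. \<bar>fst (snd t) $ i\<bar>)"
      using that fin(2) by (intro member_le_sum) (auto intro!: sum_nonneg)
    finally show ?thesis unfolding U_def by linarith
  qed
  define N where "N = Suc (card Q)"
  \<comment> \<open>\<open>m\<close> rounds need \<open>m * D\<close>, and the unfinished round
    \<open>U\<close> times a length of at most \<open>L + (m + card S) * N\<close>; \<open>a\<close>
    and \<open>b\<close> collect the terms in \<open>m\<close> and the constants. \<open>Suc\<close>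
    ensures that \<open>a\<close> is at least 1.\<close>
  define a where "a = Suc D + U * N"
  define b where "b = U * (L + card S * N)"
  have "enat (m * m) \<le> termination_complexity Q T (a * m + b)" for m
  proof -
    \<comment> \<open>Rounding up makes the multiplicities sum to at least \<open>m\<close>, as the
      coefficients sum to 1; the excess is at most \<open>card S\<close>.\<close>
    define f where "f g = nat \<lceil>real m * l g\<rceil>" for g
    have f: "real m * l g \<le> real (f g)" "real (f g) \<le> real m * l g + 1" if "g \<in> S" for g
    proof -
      have "0 \<le> real m * l g" using l(1)[OF that] by simp
      then show "real m * l g \<le> real (f g)" "real (f g) \<le> real m * l g + 1"
        unfolding f_def by linarith+
    qed
    obtain ts where ts: "walk T p0 ts p0"
      "\<And>i. effect ts $ i = K $ i + (\<Sum>g\<in>S. int (f g) * effect g $ i)"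
      "length ts = L + (\<Sum>g\<in>S. f g * length g)" using KL[of f] by blast
    have glen: "1 \<le> length g" "length g \<le> N" if "g \<in> S" for g
      using that S(1) by (auto simp: short_cycles_def N_def Suc_le_eq)
    have fsum: "real m \<le> (\<Sum>g\<in>S. real (f g))" "(\<Sum>g\<in>S. real (f g)) \<le> real m + real (card S)"
    proof -
      have eq: "(\<Sum>g\<in>S. real m * l g) = real m" using l(2) by (simp add: sum_distrib_left[symmetric])
      show "real m \<le> (\<Sum>g\<in>S. real (f g))"
        using sum_mono[of S "\<lambda>g. real m * l g" "\<lambda>g. real (f g)"] f(1) eq by simp
      show "(\<Sum>g\<in>S. real (f g)) \<le> real m + real (card S)"
        using sum_mono[of S "\<lambda>g. real (f g)" "\<lambda>g. real m * l g + 1"] f(2) eq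
        by (simp add: sum.distrib)
    qed
    have fsum': "m \<le> sum f S" "sum f S \<le> m + card S"
      using fsum by (simp_all flip: of_nat_sum of_nat_add)
    have len1: "m \<le> length ts"
    proof -
      have "sum f S \<le> (\<Sum>g\<in>S. f g * length g)"
        using glen(1) by (intro sum_mono) (metis mult.right_neutral mult_le_mono2)
      then show ?thesis using fsum'(1) ts(3) by simp
    qed
    have len2: "length ts \<le> L + (m + card S) * N"
    proof -
      have "(\<Sum>g\<in>S. f g * length g) \<le> (\<Sum>g\<in>S. f g * N)"
        using glen(2) by (intro sum_mono mult_le_mono2)
      also have "\<dots> = sum f S * N" by (simp add: sum_distrib_right)
      also have "\<dots> \<le> (m + card S) * N" using fsum'(2) by (rule mult_le_mono1)
      finally show ?thesis using ts(3) by simp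
    qed
    \<comment> \<open>Compare with \<open>m\<close> times the real combination, which is
      nonnegative: rounding moves each coefficient by at most 1, hence each summand by at most the
      absolute effect of its cycle.\<close>
    have eff: "- int D \<le> effect ts $ i" for i
    proof -
      have "real_of_int (- (\<Sum>g\<in>S. \<bar>effect g $ i\<bar>)) = (\<Sum>g\<in>S. - \<bar>real_of_int (effect g $ i)\<bar>)"
        by (simp add: sum_negf)
      also have "\<dots> \<le> real m * (\<Sum>g\<in>S. l g * of_int (effect g $ i))
          + (\<Sum>g\<in>S. - \<bar>real_of_int (effect g $ i)\<bar>)"
        using l(3)[of i] by simp
      also have "\<dots> = (\<Sum>g\<in>S. real m * l g * of_int (effect g $ i) - \<bar>real_of_int (effect g $ i)\<bar>)"
        by (simp add: sum_distrib_left sum_subtractf sum_negf mult.assoc)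
      also have "\<dots> \<le> (\<Sum>g\<in>S. real (f g) * real_of_int (effect g $ i))"
      proof (rule sum_mono)
        fix g assume g: "g \<in> S"
        define x where "x = real_of_int (effect g $ i)"
        have "\<bar>(real m * l g - real (f g)) * x\<bar> \<le> 1 * \<bar>x\<bar>"
          unfolding abs_mult using f[OF g] by (intro mult_right_mono) auto
        then show "real m * l g * of_int (effect g $ i) - \<bar>real_of_int (effect g $ i)\<bar>
            \<le> real (f g) * real_of_int (effect g $ i)"
          unfolding x_def[symmetric] by (simp add: left_diff_distrib)
      qed
      also have "\<dots> = real_of_int (\<Sum>g\<in>S. int (f g) * effect g $ i)" by simp
      finally have "- (\<Sum>g\<in>S. \<bar>effect g $ i\<bar>) \<le> (\<Sum>g\<in>S. int (f g) * effect g $ i)"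
        by (simp only: of_int_le_iff)
      then show ?thesis using D[of i] ts(2)[of i] by linarith
    qed
    let ?B = "int U * int (length ts)"
    let ?cyc = "concat (replicate m ts)"
    have "drop_le ?B ts"
      using walk_subset[OF ts(1)] U by (intro drop_le_length) blast
    from drop_le_replicate[OF this eff, of m]
    have drop: "drop_le (int m * int D + ?B) ?cyc" by simp
    have "m * D + U * length ts \<le> a * m + b"
    proof -
      have "U * length ts \<le> U * (L + (m + card S) * N)" using len2 by (rule mult_le_mono2)
      then show ?thesis by (simp add: a_def b_def algebra_simps)
    qed
    then have le: "int m * int D + ?B \<le> int (a * m + b)"
      by (metis of_nat_add of_nat_le_iff of_nat_mult)
    define v :: "nat ^ 'd" where "v = (\<chi> i. a * m + b)"
    have "0 \<le> int (v $ i) + effect (take k ?cyc) $ i" for k i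
      using drop[unfolded drop_le_def, rule_format, of k i] le unfolding v_def by simp
    from computation_of_walk[OF sub p0 walk_replicate[OF ts(1)] this]
    obtain cs where cs: "computation Q T (p0, v) cs" "length cs = Suc (length ?cyc)" by blast
    have "config_size (p0, v) = a * m + b" by (simp add: config_size_def v_def)
    then have "enat (length ?cyc) \<le> termination_complexity Q T (a * m + b)"
      using computation_le_termination_complexity[OF cs(1)] cs(2) p0 by (simp add: configs_def)
    moreover have "m * m \<le> length ?cyc"
      unfolding length_concat_replicate using len1 by (rule mult_le_mono2)
    ultimately show ?thesis by (meson enat_ord_simps(1) order_trans)
  qed
  moreover have "1 \<le> a" by (simp add: a_def)
  ultimately show ?thesis by blast
qed

text \<open>The arguments \<open>a * m + b\<close> are themselves linear in \<open>m\<close>, so a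
  linear bound along them would be linear in \<open>m\<close> and lose to
  \<open>m * m\<close>.\<close>

lemma not_linear_if_quadratic_lower_bound:
  fixes a b :: nat and F :: "nat \<Rightarrow> enat"
  assumes "1 \<le> a" and lb: "\<And>m. enat (m * m) \<le> F (a * m + b)"
    and fin: "\<And>n. F n < \<infinity>" and O: "(\<lambda>n. real (the_enat (F n))) \<in> O(\<lambda>n. real n)"
  shows False
proof -
  from O obtain K where "K > 0"
    and "eventually (\<lambda>n. norm (real (the_enat (F n))) \<le> K * norm (real n)) at_top"
    using landau_o.bigE by blast
  then obtain n0 where n0: "\<And>n. n \<ge> n0 \<Longrightarrow> real (the_enat (F n)) \<le> K * real n"
    by (auto simp: eventually_at_top_linorder)
  define m where "m = n0 + nat \<lceil>K * real (a + b)\<rceil> + 1"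
  have m: "real m > K * real (a + b)" "m \<ge> 1" "m \<ge> n0"
    unfolding m_def by (linarith | simp)+
  have "m \<le> a * m" using assms(1) by simp
  then have n: "a * m + b \<ge> n0" using m(3) by linarith
  \<comment> \<open>Finiteness matters: \<open>the_enat\<close> is unspecified at infinity.\<close>
  obtain x where x: "F (a * m + b) = enat x" using fin[of "a * m + b"] by auto
  have "m * m \<le> x" using lb[of m] x by simp
  then have "real m * real m \<le> real x" by (metis of_nat_le_iff of_nat_mult)
  also have "\<dots> \<le> K * real (a * m + b)" using n0[OF n] x by simp
  also have "\<dots> \<le> K * (real (a + b) * real m)"
    using m(2) \<open>K > 0\<close> mult_left_mono[of 1 "real m" "real b"]
    by (intro mult_left_mono) (auto simp: algebra_simps)
  also have "\<dots> < real m * real m"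
    using mult_strict_right_mono[OF m(1), of "real m"] m(2) by (simp add: mult.assoc)
  finally show False by simp
qed

section \<open>From linear complexity to a ranking function\<close>

lemma ranking_function_if_linear:
  fixes T :: "('q, 'd::finite) transition set"
  assumes V: "vass Q T" and sc: "strongly_connected Q T" and fin: "terminating Q T"
    and O: "(\<lambda>n. real (the_enat (termination_complexity Q T n))) \<in> O(\<lambda>n. real n)"
  shows "\<exists>f. ranking_function Q T f"
proof -
  define C where "C = short_cycles Q T"
  have finC: "finite C" using V by (simp add: C_def finite_short_cycles vass_def)
  define E where "E ts = (\<chi> i. real_of_int (effect ts $ i))" for ts :: "('q, 'd) transition list"
  have "\<not> (\<exists>l. (\<forall>x\<in>E ` C. 0 \<le> l x) \<and> sum l (E ` C) = (1::real) \<and>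
      (\<forall>i. 0 \<le> (\<Sum>x\<in>E ` C. l x * x $ i)))"
  proof
    assume "\<exists>l. (\<forall>x\<in>E ` C. 0 \<le> l x) \<and> sum l (E ` C) = (1::real) \<and>
      (\<forall>i. 0 \<le> (\<Sum>x\<in>E ` C. l x * x $ i))"
    then obtain l where l: "\<forall>x\<in>E ` C. 0 \<le> l x" "sum l (E ` C) = (1::real)"
      "\<forall>i. 0 \<le> (\<Sum>x\<in>E ` C. l x * x $ i)" by blast
    \<comment> \<open>Different cycles may share an effect. One representative per effect turns
      coefficients on vectors into coefficients on cycles.\<close>
    obtain S where S: "S \<subseteq> C" "inj_on E S" "E ` C = E ` S"
      using subset_image_inj[of "E ` C" E C] by auto
    have "finite S" using S(1) finC by (rule finite_subset)
    moreover have "sum (l \<circ> E) S = 1"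
      using l(2) S(2,3) by (simp add: sum.reindex)
    moreover have "0 \<le> (\<Sum>g\<in>S. (l \<circ> E) g * of_int (effect g $ i))" for i
    proof -
      have "(\<Sum>x\<in>E ` C. l x * x $ i) = (\<Sum>g\<in>S. l (E g) * E g $ i)"
        using S(2,3) by (simp add: sum.reindex)
      then show ?thesis using l(3)[rule_format, of i] by (simp add: E_def)
    qed
    moreover have "0 \<le> (l \<circ> E) g" if "g \<in> S" for g
      using l(1) S(1) that by auto
    ultimately have "\<exists>a b :: nat. 1 \<le> a \<and>
        (\<forall>m. enat (m * m) \<le> termination_complexity Q T (a * m + b))"
      using quadratic_lower_bound[OF V sc, of S "l \<circ> E"] S(1) unfolding C_def by blast
    then show False
      using not_linear_if_quadratic_lower_bound O fin unfolding terminating_def by blast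
  qed
  then obtain c where "\<And>i. 0 \<le> c $ i" "\<And>x. x \<in> E ` C \<Longrightarrow> c \<bullet> x < 0"
    using nonneg_separation_or_convex_combination[of "E ` C"] finC by blast
  then obtain r :: "rat ^ 'd" where r: "\<And>i. 0 \<le> r $ i"
    "\<And>x. x \<in> E ` C \<Longrightarrow> (\<Sum>i\<in>UNIV. of_rat (r $ i) * x $ i) < 0"
    using rational_nonneg_perturbation[of "E ` C" c] finC by blast
  define d where "d ts = (\<Sum>i\<in>UNIV. r $ i * of_int (effect ts $ i))" for ts :: "('q, 'd) transition list"
  have d: "d ts < 0" if "ts \<in> C" for ts
  proof -
    have "real_of_rat (d ts) = (\<Sum>i\<in>UNIV. of_rat (r $ i) * E ts $ i)"
      by (simp add: d_def E_def of_rat_sum of_rat_mult)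
    also have "\<dots> < 0" using r(2) that by blast
    finally show ?thesis by simp
  qed
  \<comment> \<open>A scaling factor that makes every short cycle lose at least its length. The sum
    of these nonnegative quotients dominates each of them.\<close>
  define M where "M = (\<Sum>ts\<in>C. of_nat (length ts) / - d ts)"
  have Mpos: "0 \<le> M" unfolding M_def
    by (intro sum_nonneg) (use d in \<open>auto intro!: divide_nonneg_neg simp: less_imp_le\<close>)
  have M: "M * d ts \<le> - of_nat (length ts)" if "ts \<in> C" for ts
  proof -
    have "of_nat (length ts) / - d ts \<le> M"
      unfolding M_def using that finC d
      by (intro member_le_sum[where f = "\<lambda>ts. of_nat (length ts) / - d ts"])
        (auto simp: divide_nonneg_neg)
    then show ?thesis using d[OF that] by (simp add: field_simps)
  qed
  define c' :: "rat ^ 'd" where "c' = (\<chi> i. M * r $ i)"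
  have "(\<Sum>i\<in>UNIV. c' $ i * of_int (effect ts $ i)) \<le> - of_nat (length ts)"
    if "ts \<in> short_cycles Q T" for ts
    using M[of ts] that by (simp add: c'_def d_def C_def sum_distrib_left mult.assoc)
  from ranked_if_cycles_decrease[OF V this] obtain w where "\<forall>t\<in>T. ranked c' w t" by blast
  moreover have "\<forall>i. 0 \<le> c' $ i" using Mpos r(1) by (simp add: c'_def)
  ultimately have "ranking_function Q T (\<lambda>(p, v). (\<Sum>i\<in>UNIV. c' $ i * of_nat (v $ i)) + w p)"
    unfolding ranking_function_def is_linear_map_def
    by (intro exI[of _ c'] exI[of _ w]) auto
  then show ?thesis by blast
qed

section \<open>From a ranking function to linear complexity\<close>

text \<open>The linear map loses at least 1 per step, never falls below the least
  \<open>w\<close>-value on \<open>Q\<close> because \<open>c\<close> and the counters are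
  nonnegative, and starts at most linear in the size.\<close>

lemma computation_length_le:
  fixes T :: "('q, 'd::finite) transition set" and c :: "rat ^ 'd"
  assumes "vass Q T" and c: "\<And>i. 0 \<le> c $ i" and rk: "\<And>t. t \<in> T \<Longrightarrow> ranked c w t"
  shows "\<exists>A B. \<forall>c0 cs. computation Q T c0 cs \<longrightarrow> length cs - 1 \<le> A * config_size c0 + B"
proof -
  have fin: "finite Q" "Q \<noteq> {}" using assms(1) by (auto simp: vass_def)
  define g where "g x = (\<Sum>i\<in>UNIV. c $ i * of_nat (snd x $ i)) + w (fst x)"
    for x :: "('q, 'd) config"
  define wmax wmin where "wmax = Max (w ` Q)" and "wmin = Min (w ` Q)"
  have wb: "w p \<le> wmax" "wmin \<le> w p" if "p \<in> Q" for p
    using fin that by (auto simp: wmax_def wmin_def)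
  have gstep: "g x' \<le> g x - 1" if st: "step T x x'" for x x'
  proof -
    obtain u where u: "(fst x, u, fst x') \<in> T" "\<And>i. int (snd x' $ i) = int (snd x $ i) + u $ i"
      using st unfolding step_def by blast
    have e: "of_nat (snd x' $ i) = (of_nat (snd x $ i) + of_int (u $ i) :: rat)" for i
      using arg_cong[OF u(2)[of i], of "of_int :: int \<Rightarrow> rat"] by simp
    show ?thesis
      using rk[OF u(1)] by (simp add: g_def ranked_def e algebra_simps sum.distrib)
  qed
  have "length cs - 1 \<le> nat \<lceil>sum (($) c) UNIV\<rceil> * config_size c0 + nat \<lceil>wmax - wmin\<rceil>"
    if comp: "computation Q T c0 cs" for c0 cs
  proof -
    from comp have ne: "cs \<noteq> []" and hd: "cs ! 0 = c0" and sub: "set cs \<subseteq> configs Q"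
      by (auto simp: computation_def hd_conv_nth)
    have dec: "g (cs ! i) \<le> g c0 - of_nat i" if "i < length cs" for i
      using that
    proof (induction i)
      case 0
      then show ?case using hd by simp
    next
      case (Suc i)
      then have "step T (cs ! i) (cs ! Suc i)" using comp by (simp add: computation_def)
      from gstep[OF this] Suc show ?case by simp
    qed
    let ?n = "length cs - 1"
    have n: "?n < length cs" using ne by (cases cs) auto
    have inQ: "fst (cs ! i) \<in> Q" if "i < length cs" for i
      using subsetD[OF sub nth_mem[OF that]] by (auto simp: configs_def)
    have "wmin \<le> g (cs ! ?n)"
      unfolding g_def using wb(2)[OF inQ[OF n]] c by (simp add: add_increasing sum_nonneg)
    then have "of_nat ?n \<le> g c0 - wmin" using dec[OF n] by linarith
    also have "g c0 \<le> sum (($) c) UNIV * of_nat (config_size c0) + wmax"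
    proof -
      have "(\<Sum>i\<in>UNIV. c $ i * of_nat (snd c0 $ i)) \<le> (\<Sum>i\<in>UNIV. c $ i * of_nat (config_size c0))"
        using c by (intro sum_mono mult_left_mono) (auto simp: config_size_def)
      moreover have "w (fst c0) \<le> wmax" using wb(1) inQ[of 0] ne hd by auto
      ultimately show ?thesis by (simp add: g_def sum_distrib_right)
    qed
    also have "sum (($) c) UNIV \<le> of_nat (nat \<lceil>sum (($) c) UNIV\<rceil>)" by (rule of_nat_ceiling)
    finally have "of_nat ?n \<le> of_nat (nat \<lceil>sum (($) c) UNIV\<rceil>) * of_nat (config_size c0) + wmax - wmin"
      by (simp add: mult_right_mono)
    also have "\<dots> \<le> of_nat (nat \<lceil>sum (($) c) UNIV\<rceil>) * of_nat (config_size c0)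
        + of_nat (nat \<lceil>wmax - wmin\<rceil>)"
      using of_nat_ceiling[of "wmax - wmin"] by linarith
    finally show ?thesis by (metis of_nat_add of_nat_le_iff of_nat_mult)
  qed
  then show ?thesis by blast
qed

lemma linear_if_ranking_function:
  fixes T :: "('q, 'd::finite) transition set"
  assumes V: "vass Q T" and R: "ranking_function Q T f"
  shows "terminating Q T \<and>
    (\<lambda>n. real (the_enat (termination_complexity Q T n))) \<in> O(\<lambda>n. real n)"
proof -
  from R obtain c w where "\<And>i. 0 \<le> c $ i" "\<And>t. t \<in> T \<Longrightarrow> ranked c w t"
    unfolding ranking_function_def by blast
  from computation_length_le[OF V this] obtain A B
    where AB: "\<And>c0 cs. computation Q T c0 cs \<Longrightarrow> length cs - 1 \<le> A * config_size c0 + B"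
    by blast
  have le: "termination_complexity Q T n \<le> enat (A * n + B)" for n
    unfolding termination_complexity_def comp_bound_def
    by (intro SUP_least) (use AB in auto)
  then have fin: "termination_complexity Q T n < \<infinity>" for n
    using enat_ord_simps(4) order.strict_trans1 by blast
  \<comment> \<open>The constant \<open>B\<close> is absorbed into the factor of \<open>n\<close>,
    which needs \<open>n\<close> to be at least 1.\<close>
  have "real (the_enat (termination_complexity Q T n)) \<le> real (A + B) * real n" if "n \<ge> 1" for n
  proof -
    obtain x where x: "termination_complexity Q T n = enat x" using fin[of n] by auto
    have "x \<le> A * n + B" using le[of n] x by simp
    also have "\<dots> \<le> (A + B) * n" using that by (simp add: algebra_simps)
    finally show ?thesis using x by (metis of_nat_le_iff of_nat_mult the_enat.simps)
  qed
  then have "(\<lambda>n. real (the_enat (termination_complexity Q T n))) \<in> O(\<lambda>n. real n)"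
    by (intro bigoI[of _ "real (A + B)"]) (auto simp: eventually_at_top_linorder intro!: exI[of _ 1])
  with fin show ?thesis by (simp add: terminating_def)
qed

theorem mainTheorem1:
  fixes Q :: "'q set" and T :: "('q, 'd::finite) transition set"
  assumes "vass Q T" and "strongly_connected Q T"
  shows "(terminating Q T \<and>
           (\<lambda>n. real (the_enat (termination_complexity Q T n))) \<in> O(\<lambda>n. real n))
         \<longleftrightarrow> (\<exists>f. ranking_function Q T f)"
proof
  assume "terminating Q T \<and>
    (\<lambda>n. real (the_enat (termination_complexity Q T n))) \<in> O(\<lambda>n. real n)"
  then show "\<exists>f. ranking_function Q T f"
    by (elim conjE) (rule ranking_function_if_linear[OF assms])
next
  assume "\<exists>f. ranking_function Q T f"
  then show "terminating Q T \<and>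
    (\<lambda>n. real (the_enat (termination_complexity Q T n))) \<in> O(\<lambda>n. real n)"
    by (elim exE) (rule linear_if_ranking_function[OF assms(1)])
qed

end
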